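(* There exists $n_0$ such that for all $n \ge n_0$ the following holds. Let $L \colon \mathbb{F}_2^n \to \mathbb{F}_2^n$ be an invertible linear map, let $x_1, x_2 \in \mathbb{F}_2^n$, let $r < n/2 - 7$, and set $A_1 = B_r(x_1)$ and $A_2 = L B_r(x_2)$. Suppose that $S \subseteq \mathbb{F}_2^n$ satisfies $\mathbb{F}_2^n = A_1 \cup A_2 \cup S$. Then $S + S = \mathbb{F}_2^n$.
   Context: For $x, y \in \mathbb{F}_2^n$, $d(x,y)$ denotes the Hamming distance, i.e. the number of indices $i \in \{1,\dots,n\}$ with $x_i \neq y_i$. For a real number $r$, $B_r(x) = \{y \in \mathbb{F}_2^n : d(x,y) \le r\}$ is the Hamming ball of radius $r$ around $x$. For a linear map $L \colon \mathbb{F}_2^n \to \mathbb{F}_2^n$, $L B_r(x) = \{Ly : y \in B_r(x)\}$. For $A, B \subseteq \mathbb{F}_2^n$, $A + B = \{a + b : a \in A, b \in B\}$. *)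

theory Defs
  imports
    Complex_Main
    "HOL-Library.Z2"
    "HOL-Library.Set_Algebras"
    "Jordan_Normal_Form.VS_Connect"
begin

text \<open>
  The space \<open>\<bbbF>\<^sub>2\<^sup>n\<close> is \<^term>\<open>carrier_vec n :: bit vec set\<close>, where \<^typ>\<open>bit\<close> is the
  two-element field; coordinates are indexed by \<open>0, \<dots>, n - 1\<close>.
\<close>

text \<open>Only meaningful for vectors of equal dimension.\<close>

definition hamming_dist :: "'a vec \<Rightarrow> 'a vec \<Rightarrow> nat" where
  "hamming_dist x y = card {i. i < dim_vec x \<and> x $ i \<noteq> y $ i}"

definition hamming_ball :: "nat \<Rightarrow> real \<Rightarrow> bit vec \<Rightarrow> bit vec set" where
  "hamming_ball n r x = {y \<in> carrier_vec n. real (hamming_dist x y) \<le> r}"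

definition invertible_linear_map :: "nat \<Rightarrow> (bit vec \<Rightarrow> bit vec) \<Rightarrow> bool" where
  "invertible_linear_map n L \<longleftrightarrow>
     linear_map class_ring (module_vec TYPE(bit) n) (module_vec TYPE(bit) n) L \<and>
     bij_betw L (carrier_vec n) (carrier_vec n)"

end

theory Submission
  imports Defs "HOL-Library.Function_Algebras" "HOL-Library.Disjoint_Sets"
begin

text \<open>
  Given \<open>z\<close>, we need \<open>y\<close> such that \<open>y\<close> and \<open>y + z\<close> avoid both balls. Let \<open>Z\<close> be the support of \<open>z\<close> and
  consider disjoint blocks of coordinates, each block being either a single index outside \<open>Z\<close> or a
  pair inside \<open>Z\<close>. If the coordinates of \<open>x\<^sub>1 + y\<close> sum to \<open>1\<close> over a block, then \<open>y\<close> differs from \<open>x\<^sub>1\<close>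
  somewhere in that block, and so does \<open>y + z\<close>, since \<open>z\<close> sums to \<open>0\<close> over every block. Hence
  \<open>n/2 - O(1)\<close> such linear equations on \<open>y\<close> keep \<open>y\<close> and \<open>y + z\<close> outside \<open>B\<^sub>r(x\<^sub>1)\<close>, and likewise
  \<open>n/2 - O(1)\<close> equations on the coordinates of \<open>L\<^sup>-\<^sup>1 y\<close> deal with the second ball. It remains to
  choose the two families of blocks so that all these equations, as vectors of the dual space, are
  jointly linearly independent, and hence solvable.

  A family of pairs whose differences are independent modulo a given subspace and which is
  maximal either covers all but two indices or spans all differences (otherwise re-pairing two of its
  elements with two uncovered indices enlarges it). Let \<open>Z'\<close> be the support of \<open>L\<^sup>-\<^sup>1 z\<close> and \<open>X'\<close> the span
  of the second family of coordinate functionals over the complement of \<open>Z'\<close>. The blocks on the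
  first side are chosen to start with about \<open>|Z'|/2\<close> blocks that are independent modulo \<open>X'\<close>;
  this leaves enough room in \<open>X'\<close> for the blocks on the second side.
\<close>

section \<open>Arithmetic in the two-element field\<close>

declare add_bit_eq_xor [simp del] mult_bit_eq_and [simp del]

lemma bit_add_self [simp]: "a + a = (0::bit)"
  by (cases a) simp_all

lemma sum_apply: "(\<Sum>j\<in>A. f j) k = (\<Sum>j\<in>A. f j k)"
  by (induction A rule: infinite_finite_induct) simp_all

section \<open>Block systems\<close>

text \<open>In the application \<open>Z\<close> is the support of a vector and \<open>K\<close> its
  complement, so that the vector sums to 0 over every block.\<close>

definition block_system :: "'i set \<Rightarrow> 'i set \<Rightarrow> 'i set set \<Rightarrow> bool" where
  "block_system K Z F \<longleftrightarrow>
     disjoint F \<and> (\<forall>P\<in>F. (\<exists>i\<in>K. P = {i}) \<or> P \<subseteq> Z \<and> card P = 2)"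

lemma block_system_mono: "block_system K Z F \<Longrightarrow> G \<subseteq> F \<Longrightarrow> block_system K Z G"
  by (auto simp: block_system_def intro: pairwise_subset)

lemma block_system_subset: "block_system K Z F \<Longrightarrow> P \<in> F \<Longrightarrow> P \<subseteq> K \<union> Z"
  by (auto simp: block_system_def)

lemma block_system_nonempty: "block_system K Z F \<Longrightarrow> P \<in> F \<Longrightarrow> P \<noteq> {}"
  by (auto simp: block_system_def)

lemma finite_block_system:
  assumes "block_system K Z F" "finite K" "finite Z"
  shows "finite F"
proof (rule finite_subset)
  show "F \<subseteq> Pow (K \<union> Z)"
    using block_system_subset[OF assms(1)] by blast
qed (use assms in simp)

text \<open>Blocks have at most two elements, so fewer than \<open>m\<close> of them leave two
  indices of \<open>K \<union> Z\<close> uncovered. One of these in \<open>K\<close> gives a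
  singleton block; otherwise both lie in \<open>Z\<close> and form a pair.\<close>

lemma extend_block_system:
  assumes "finite K" "finite Z" "2 * m \<le> card (K \<union> Z)" "block_system K Z F" "card F \<le> m"
  obtains G where "F \<subseteq> G" "block_system K Z G" "card G = m"
proof -
  have "\<exists>G. F \<subseteq> G \<and> block_system K Z G \<and> card G = m"
    using assms(4,5)
  proof (induction "m - card F" arbitrary: F)
    case 0
    then show ?case by auto
  next
    case (Suc d)
    have fin: "finite F"
      using finite_block_system Suc.prems assms by blast
    have "card (\<Union>F) \<le> sum card F"
      by (rule card_Union_le_sum_card)
    also have "\<dots> \<le> (\<Sum>P\<in>F. 2)"
      using Suc.prems(1) unfolding block_system_def by (intro sum_mono) force
    finally have "card (\<Union>F) \<le> 2 * card F"
      by simp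
    then have "card (\<Union>F) + 2 \<le> card (K \<union> Z)"
      using Suc.hyps(2) assms(3) by linarith
    moreover have "card (K \<union> Z - \<Union>F) = card (K \<union> Z) - card (\<Union>F)"
      using block_system_subset[OF Suc.prems(1)] assms(1,2)
      by (intro card_Diff_subset) (auto intro: finite_subset[of _ "K \<union> Z"])
    ultimately have "2 \<le> card (K \<union> Z - \<Union>F)"
      by linarith
    then obtain J where "J \<subseteq> K \<union> Z - \<Union>F" "card J = 2"
      using obtain_subset_with_card_n by metis
    then obtain i j where ij: "i \<noteq> j" "i \<in> K \<union> Z - \<Union>F" "j \<in> K \<union> Z - \<Union>F"
      by (auto simp: card_2_iff)
    define P where "P = (if i \<in> K then {i} else if j \<in> K then {j} else {i, j})"
    have P: "P \<noteq> {}" "P \<inter> \<Union>F = {}" "(\<exists>i\<in>K. P = {i}) \<or> P \<subseteq> Z \<and> card P = 2"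
      using ij by (auto simp: P_def)
    then have "P \<notin> F"
      by blast
    moreover have "disjoint (insert P F)"
      using Suc.prems(1) P(2) unfolding block_system_def disjoint_def pairwise_insert disjnt_def by blast
    then have "block_system K Z (insert P F)"
      using Suc.prems(1) P(3) unfolding block_system_def by blast
    moreover have "d = m - card (insert P F)" "card (insert P F) \<le> m"
      using \<open>P \<notin> F\<close> fin Suc.hyps(2) by simp_all
    ultimately show ?case
      using Suc.hyps(1)[of "insert P F"] by blast
  qed
  then show ?thesis
    using that by blast
qed

section \<open>Dimension counting and matchings over the two-element field\<close>

locale bit_vector_space = vector_space scale
  for scale :: "bit \<Rightarrow> 'v::ab_group_add \<Rightarrow> 'v"
begin

lemma add_self [simp]: "x + x = (0::'v)"
proof -
  have "scale 1 x + scale 1 x = scale (1 + 1) x"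
    by (rule scale_left_distrib [symmetric])
  then show ?thesis
    by simp
qed

lemma diff_eq_add: "x - y = x + (y::'v)"
  by (simp add: diff_eq_eq add.assoc)

text \<open>The only scalars are 0 and 1, so the new span consists of two cosets of the old
  one.\<close>

lemma span_insert_iff: "x \<in> span (insert a A) \<longleftrightarrow> x \<in> span A \<or> x + a \<in> span A"
proof
  assume "x \<in> span (insert a A)"
  then obtain k where k: "x - scale k a \<in> span A"
    using span_breakdown_eq by blast
  then show "x \<in> span A \<or> x + a \<in> span A"
    by (cases k) (simp_all add: diff_eq_add)
next
  assume "x \<in> span A \<or> x + a \<in> span A"
  then have "x - scale 0 a \<in> span A \<or> x - scale 1 a \<in> span A"
    by (simp add: diff_eq_add)
  then show "x \<in> span (insert a A)"
    using span_breakdown_eq by blast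
qed

text \<open>The space used later, all functions \<open>nat \<Rightarrow> bit\<close>, is
  infinite-dimensional; dimensions are therefore counted for spans of finite sets.\<close>

lemma dim_insert_finite:
  assumes "finite A"
  shows "dim (insert x A) = (if x \<in> span A then dim A else Suc (dim A))"
proof -
  obtain B where B: "B \<subseteq> A" "independent B" "A \<subseteq> span B" "card B = dim A"
    using basis_exists by blast
  then have sp: "span A = span B"
    by (metis span_eq span_superset order_trans)
  have fin: "finite B"
    using B(1) assms finite_subset by blast
  show ?thesis
  proof (cases "x \<in> span A")
    case True
    then show ?thesis
      by (metis dim_span span_redundant)
  next
    case False
    then have "independent (insert x B)" "x \<notin> B"
      using B sp by (auto simp: independent_insertI dest: span_base)
    moreover have "insert x A \<subseteq> span (insert x B)"
      using B(3) span_mono[of B "insert x B"] by (auto intro: span_base)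
    ultimately have "dim (insert x A) = card (insert x B)"
      using dim_unique[of "insert x B" "insert x A"] B(1) by blast
    then show ?thesis
      using False fin \<open>x \<notin> B\<close> B(4) by simp
  qed
qed

lemma dim_mono_finite:
  assumes "finite B" "A \<subseteq> span B"
  shows "dim A \<le> dim B"
proof -
  obtain C where C: "C \<subseteq> B" "independent C" "B \<subseteq> span C" "card C = dim B"
    using basis_exists by blast
  then have "span B = span C"
    by (metis span_eq span_superset order_trans)
  then show ?thesis
    using dim_le_card[of A C] assms C finite_subset by metis
qed

lemma dim_union_le:
  assumes "finite A" "finite I"
  shows "dim (A \<union> f ` I) \<le> dim A + card I"
  using assms(2)
proof induction
  case (insert i I)
  then have "dim (insert (f i) (A \<union> f ` I)) \<le> Suc (dim (A \<union> f ` I))"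
    using assms(1) by (simp add: dim_insert_finite)
  with insert show ?case
    by simp
qed simp

text \<open>The dimension equation encodes, here and below, that the family \<open>f\<close> over
  \<open>M\<close> is independent modulo \<open>span B\<close>, injectivity included. The members
  over \<open>M - N\<close> contribute at most \<open>card (M - N)\<close>, so those over
  \<open>N\<close> must contribute \<open>card N\<close>.\<close>

lemma dim_subfamily:
  assumes "finite B" "finite M" "dim (B \<union> f ` M) = dim B + card M" "N \<subseteq> M"
  shows "dim (B \<union> f ` N) = dim B + card N"
proof -
  have "finite N"
    using assms(2,4) by (rule rev_finite_subset)
  then have "dim (B \<union> f ` N \<union> f ` (M - N)) \<le> dim (B \<union> f ` N) + card (M - N)"
    using assms by (intro dim_union_le) auto
  moreover have "B \<union> f ` N \<union> f ` (M - N) = B \<union> f ` M"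
    using assms(4) by auto
  moreover have "card M = card N + card (M - N)"
    using assms(2,4) \<open>finite N\<close> by (simp add: card_Diff_subset card_mono)
  moreover have "dim (B \<union> f ` N) \<le> dim B + card N"
    using assms(1) \<open>finite N\<close> by (rule dim_union_le)
  ultimately show ?thesis
    using assms(3) by simp
qed

text \<open>
  For a matching \<open>M\<close> of maximal size with three uncovered indices \<open>a, b, c\<close>, suppose that a matched
  pair \<open>{i, k}\<close> has \<open>v i + v a\<close> outside the span \<open>T\<close>. Removing the pair leaves a subspace \<open>T'\<close> of
  index 2 in \<open>T\<close>, so two of \<open>a, b, c\<close>, say \<open>j\<close> and \<open>j'\<close>, satisfy \<open>v j + v j' \<in> T'\<close>;
  replacing \<open>{i, k}\<close> by \<open>{i, j}\<close> and \<open>{k, j'}\<close> then contradicts maximality.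
\<close>

lemma exists_matching:
  fixes v :: "'i \<Rightarrow> 'v"
  assumes "finite I" "finite B"
  obtains M where "\<And>P. P \<in> M \<Longrightarrow> P \<subseteq> I \<and> card P = 2" "disjoint M"
    "dim (B \<union> sum v ` M) = dim B + card M"
    "card I \<le> 2 * card M + 2 \<or> (\<forall>i\<in>I. \<forall>j\<in>I. v i + v j \<in> span (B \<union> sum v ` M))"
proof -
  define good where "good M \<longleftrightarrow> M \<subseteq> {P. P \<subseteq> I \<and> card P = 2} \<and> disjoint M \<and>
    dim (B \<union> sum v ` M) = dim B + card M" for M
  have fin_good: "finite M" if "good M" for M
  proof (rule finite_subset)
    show "M \<subseteq> Pow I"
      using that by (auto simp: good_def)
  qed (use assms(1) in simp)
  have card_Un: "card (\<Union>M) = 2 * card M" if "good M" for M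
  proof -
    have "card (\<Union>M) = sum card M"
      using that assms(1) unfolding good_def disjoint_def
      by (intro card_Union_disjoint) (auto simp: pairwise_def disjnt_def intro: finite_subset)
    also have "\<dots> = 2 * card M"
      using that unfolding good_def by (subst sum.cong[of M M card "\<lambda>_. 2"]) auto
    finally show ?thesis .
  qed
  have "good {}"
    by (simp add: good_def)
  moreover have "card M < Suc (card I)" if "good M" for M
  proof -
    have "card (\<Union>M) \<le> card I"
      using that assms(1) by (intro card_mono) (auto simp: good_def)
    then show ?thesis
      using card_Un[OF that] by simp
  qed
  ultimately obtain M where M: "good M" and max: "\<And>N. good N \<Longrightarrow> card N \<le> card M"
    using ex_has_greatest_nat[of good "{}" card "Suc (card I)"] by (meson less_imp_le)
  have finM: "finite M"
    using fin_good[OF M] .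
  let ?T = "span (B \<union> sum v ` M)"
  have good_insert: "good (insert {i, j} N)" "card (insert {i, j} N) = Suc (card N)"
    if gN: "good N" and ij: "i \<in> I - \<Union>N" "j \<in> I - \<Union>N" "i \<noteq> j"
      and ns: "v i + v j \<notin> span (B \<union> sum v ` N)" for N i j
  proof -
    have new: "{i, j} \<notin> N"
      using ij by auto
    moreover have "disjoint (insert {i, j} N)"
      using gN ij unfolding good_def disjoint_def pairwise_def disjnt_def by auto
    moreover have "dim (insert (v i + v j) (B \<union> sum v ` N)) = Suc (dim (B \<union> sum v ` N))"
      using ns assms(2) fin_good[OF gN] by (simp add: dim_insert_finite)
    ultimately show "good (insert {i, j} N)"
      using gN ij fin_good[OF gN] unfolding good_def by simp
    show "card (insert {i, j} N) = Suc (card N)"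
      using new fin_good[OF gN] by simp
  qed
  have unmatched: "v i + v j \<in> ?T" if "i \<in> I - \<Union>M" "j \<in> I - \<Union>M" for i j
  proof (cases "i = j")
    case True
    then show ?thesis by (simp add: span_zero)
  next
    case False
    then show ?thesis
      using good_insert[OF M that False] max[of "insert {i, j} M"] by fastforce
  qed
  have "\<forall>i\<in>I. \<forall>j\<in>I. v i + v j \<in> ?T" if big: "card I > 2 * card M + 2"
  proof -
    have "card (I - \<Union>M) = card I - card (\<Union>M)"
      using M assms(1) by (intro card_Diff_subset) (auto simp: good_def intro: finite_subset)
    then have "3 \<le> card (I - \<Union>M)"
      using big card_Un[OF M] by simp
    then obtain J where J: "J \<subseteq> I - \<Union>M" "card J = 3"
      using obtain_subset_with_card_n by metis
    then obtain a b c where abc: "a \<noteq> b" "b \<noteq> c" "a \<noteq> c" "{a, b, c} \<subseteq> I - \<Union>M"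
      unfolding card_3_iff by auto
    have matched: "v i + v a \<in> ?T" if iM: "i \<in> \<Union>M" for i
    proof (rule ccontr)
      assume nT: "v i + v a \<notin> ?T"
      obtain P where P: "P \<in> M" "i \<in> P"
        using iM by blast
      then have "card P = 2"
        using M by (auto simp: good_def)
      then obtain k where k: "P = {i, k}" "i \<noteq> k"
        using P(2) by (auto simp: card_2_iff)
      define N where "N = M - {P}"
      have MN: "M = insert P N" "P \<notin> N"
        using P by (auto simp: N_def)
      have finN: "finite N"
        using finM by (simp add: N_def)
      have N: "good N"
        using M dim_subfamily[OF assms(2) finM, of "sum v" N]
        by (auto simp: good_def N_def disjoint_def intro: pairwise_subset)
      let ?T' = "span (B \<union> sum v ` N)"
      have wM: "B \<union> sum v ` M = insert (v i + v k) (B \<union> sum v ` N)"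
        using MN k by simp
      have T: "x \<in> ?T \<longleftrightarrow> x \<in> ?T' \<or> x + (v i + v k) \<in> ?T'" for x
        unfolding wM by (rule span_insert_iff)
      have ik: "v i + v k \<notin> ?T'"
      proof
        assume "v i + v k \<in> ?T'"
        then have "dim (B \<union> sum v ` M) = dim (B \<union> sum v ` N)"
          unfolding wM using assms(2) finN by (simp add: dim_insert_finite)
        then show False
          using M N MN finN by (simp add: good_def)
      qed
      have sub: "I - \<Union>M \<subseteq> I - \<Union>N" "i \<in> I - \<Union>N" "k \<in> I - \<Union>N"
        using M P k MN unfolding good_def disjoint_def pairwise_def disjnt_def by auto
      obtain j j' where j: "j \<noteq> j'" "j \<in> I - \<Union>M" "j' \<in> I - \<Union>M" "v j + v j' \<in> ?T'"
      proof -
        have ab: "v a + v b \<in> ?T" and bc: "v b + v c \<in> ?T"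
          using unmatched abc by auto
        have "v a + v c \<in> ?T'" if "v a + v b \<notin> ?T'" "v b + v c \<notin> ?T'"
        proof -
          have "(v a + v b + (v i + v k)) + (v b + v c + (v i + v k)) \<in> ?T'"
            using ab bc that T by (blast intro: span_add)
          also have "(v a + v b + (v i + v k)) + (v b + v c + (v i + v k)) =
              (v a + v c) + (v b + v b) + ((v i + v i) + (v k + v k))"
            by (simp only: ac_simps)
          finally show ?thesis by simp
        qed
        then show thesis
          using that[of a b] that[of b c] that[of a c] abc by blast
      qed
      \<comment> \<open>All uncovered indices agree modulo \<open>?T\<close>, so \<open>j\<close>
        can take the place of \<open>a\<close>.\<close>
      have ij: "v i + v j \<notin> ?T"
      proof
        assume "v i + v j \<in> ?T"
        moreover have "v j + v a \<in> ?T"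
          using unmatched j abc by auto
        ultimately have "(v i + v j) + (v j + v a) \<in> ?T"
          by (rule span_add)
        moreover have "(v i + v j) + (v j + v a) = v i + v a + (v j + v j)"
          by (simp only: ac_simps)
        ultimately show False
          using nT by simp
      qed
      have iM_j: "i \<noteq> j" "k \<noteq> j'" "i \<noteq> j'" "k \<noteq> j"
        using j P k by auto
      have ij': "v i + v j \<notin> ?T'"
        using ij T by blast
      have g1: "good (insert {i, j} N)" "card (insert {i, j} N) = Suc (card N)"
        using good_insert[OF N _ _ iM_j(1) ij'] sub j by auto
      \<comment> \<open>Modulo \<open>?T'\<close> the vectors \<open>v j\<close> and
        \<open>v j'\<close> agree. The first case thus puts \<open>v k + v j\<close> into
        \<open>?T'\<close>, hence \<open>v i + v j\<close> into \<open>?T\<close>; the second puts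
        \<open>v i + v k\<close> into \<open>?T'\<close>.\<close>
      have nk: "v k + v j' \<notin> span (insert (v i + v j) (B \<union> sum v ` N))"
      proof
        assume "v k + v j' \<in> span (insert (v i + v j) (B \<union> sum v ` N))"
        then consider "v k + v j' \<in> ?T'" | "v k + v j' + (v i + v j) \<in> ?T'"
          by (auto simp: span_insert_iff)
        then show False
        proof cases
          case 1
          then have "(v k + v j') + (v j + v j') \<in> ?T'"
            using j by (blast intro: span_add)
          moreover have "(v k + v j') + (v j + v j') = v k + v j + (v j' + v j')"
            by (simp only: ac_simps)
          moreover have "v i + v j + (v i + v k) = v k + v j + (v i + v i)"
            by (simp only: ac_simps)
          ultimately have "v i + v j + (v i + v k) \<in> ?T'"
            by (simp only: add_self add_0_right)
          then show False
            using ij T by blast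
        next
          case 2
          then have "(v k + v j' + (v i + v j)) + (v j + v j') \<in> ?T'"
            using j by (blast intro: span_add)
          moreover have "(v k + v j' + (v i + v j)) + (v j + v j') = v i + v k + (v j + v j) + (v j' + v j')"
            by (simp only: ac_simps)
          ultimately show False
            using ik by simp
        qed
      qed
      have "good (insert {k, j'} (insert {i, j} N))"
        "card (insert {k, j'} (insert {i, j} N)) = Suc (card (insert {i, j} N))"
        using good_insert[OF g1(1) _ _ iM_j(2)] nk sub j iM_j k(2) by auto
      then show False
        using max[of "insert {k, j'} (insert {i, j} N)"] g1(2) MN finN by simp
    qed
    have to_a: "v i + v a \<in> ?T" if "i \<in> I" for i
      using matched unmatched abc that by blast
    show ?thesis
    proof (intro ballI)
      fix i j assume "i \<in> I" "j \<in> I"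
      then have "(v i + v a) + (v j + v a) \<in> ?T"
        using to_a span_add by blast
      moreover have "(v i + v a) + (v j + v a) = v i + v j + (v a + v a)"
        by (simp only: ac_simps)
      ultimately show "v i + v j \<in> ?T"
        by simp
    qed
  qed
  then show ?thesis
    using that[of M] M by (fastforce simp: good_def not_le)
qed

section \<open>Block systems with independent sums\<close>

text \<open>Basis extension in indexed form: \<open>i\<close> is kept exactly when
  \<open>e i\<close> is not yet in the span.\<close>

lemma exists_maximal_subfamily:
  assumes "finite K" "finite B"
  shows "\<exists>S\<subseteq>K. dim (B \<union> e ` S) = dim B + card S \<and> e ` K \<subseteq> span (B \<union> e ` S)"
  using assms(1)
proof induction
  case empty
  then show ?case by simp
next
  case (insert i K)
  then obtain S where S: "S \<subseteq> K" "dim (B \<union> e ` S) = dim B + card S" "e ` K \<subseteq> span (B \<union> e ` S)"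
    by blast
  show ?case
  proof (cases "e i \<in> span (B \<union> e ` S)")
    case True
    then show ?thesis
      using S by blast
  next
    case False
    have fin: "finite S" "i \<notin> S"
      using S(1) insert.hyps finite_subset by auto
    have eq: "B \<union> e ` insert i S = insert (e i) (B \<union> e ` S)"
      by simp
    have "dim (B \<union> e ` insert i S) = dim B + card (insert i S)"
      unfolding eq using False S(2) fin assms(2) by (simp add: dim_insert_finite)
    moreover have "e ` insert i K \<subseteq> span (B \<union> e ` insert i S)"
      unfolding eq using S(3) span_mono[of "B \<union> e ` S" "insert (e i) (B \<union> e ` S)"]
      by (auto intro: span_base)
    ultimately show ?thesis
      using S(1) by blast
  qed
qed

text \<open>The singletons come from a maximal subfamily over \<open>K\<close>, the pairs from a
  matching of \<open>Z\<close> modulo everything chosen so far. If the matching misses at most two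
  indices, counting gives the second alternative. Otherwise all differences over \<open>Z\<close>
  are spanned, and adding a single \<open>e z\<close> spans everything, which gives the
  first.\<close>

lemma exists_block_system:
  fixes e :: "'i \<Rightarrow> 'v"
  assumes "finite K" "finite Z" "K \<inter> Z = {}" "finite B"
  obtains F where "block_system K Z F" "dim (B \<union> sum e ` F) = dim B + card F"
    "dim (B \<union> e ` (K \<union> Z)) \<le> dim B + card F + 1 \<or>
     2 * dim (B \<union> e ` K) + card Z \<le> 2 * (dim B + card F + 1)"
proof -
  obtain S where S: "S \<subseteq> K" "dim (B \<union> e ` S) = dim B + card S" "e ` K \<subseteq> span (B \<union> e ` S)"
    using exists_maximal_subfamily[OF assms(1,4)] by blast
  have finS: "finite S"
    using S(1) assms(1) by (rule finite_subset)
  then have finBS: "finite (B \<union> e ` S)"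
    using assms(4) by simp
  obtain M where M: "\<And>P. P \<in> M \<Longrightarrow> P \<subseteq> Z \<and> card P = 2" "disjoint M"
    "dim ((B \<union> e ` S) \<union> sum e ` M) = dim (B \<union> e ` S) + card M"
    "card Z \<le> 2 * card M + 2 \<or>
     (\<forall>i\<in>Z. \<forall>j\<in>Z. e i + e j \<in> span ((B \<union> e ` S) \<union> sum e ` M))"
    using exists_matching[OF assms(2) finBS] by blast
  have finM: "finite M"
    using M(1) assms(2) by (intro finite_subset[of M "Pow Z"]) auto
  define F where "F = (\<lambda>i. {i}) ` S \<union> M"
  have w: "B \<union> sum e ` F = (B \<union> e ` S) \<union> sum e ` M"
    by (auto simp: F_def image_Un image_image)
  have "(\<lambda>i. {i}) ` S \<inter> M = {}"
    using M(1) by force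
  then have card_F: "card F = card S + card M"
    unfolding F_def using finS finM by (simp add: card_Un_disjoint card_image)
  have "disjoint F"
    unfolding F_def using M(1,2) S(1) assms(3)
    by (fastforce simp: disjoint_def pairwise_def disjnt_def)
  then have bs: "block_system K Z F"
    using S(1) M(1) by (auto simp: block_system_def F_def)
  have dimF: "dim (B \<union> sum e ` F) = dim B + card F"
    using M(3) S(2) card_F w by simp
  have KF: "e ` K \<subseteq> span (B \<union> sum e ` F)"
    using S(3) span_mono[of "B \<union> e ` S" "B \<union> sum e ` F"] w by auto
  have finF: "finite (B \<union> sum e ` F)"
    unfolding w using finBS finM by simp
  show ?thesis
  proof (cases "card Z \<le> 2 * card M + 2")
    case True
    have "dim (B \<union> e ` K) \<le> dim (B \<union> e ` S)"
      using finBS S(3) by (intro dim_mono_finite) (auto intro: span_base)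
    then have "2 * dim (B \<union> e ` K) + card Z \<le> 2 * (dim B + card F + 1)"
      using True S(2) card_F by simp
    then show ?thesis
      using that[OF bs dimF] by blast
  next
    case False
    then obtain z where z: "z \<in> Z"
      by fastforce
    have diff: "e i + e z \<in> span (B \<union> sum e ` F)" if "i \<in> Z" for i
      using M(4) False that z w by auto
    let ?W = "insert (e z) (B \<union> sum e ` F)"
    have "e i \<in> span ?W" if "i \<in> Z" for i
      using diff[OF that] span_insert_iff by blast
    then have "B \<union> e ` (K \<union> Z) \<subseteq> span ?W"
      using KF span_mono[of "B \<union> sum e ` F" ?W] by (auto intro: span_base)
    then have "dim (B \<union> e ` (K \<union> Z)) \<le> dim ?W"
      using finF by (intro dim_mono_finite) auto
    also have "\<dots> \<le> dim (B \<union> sum e ` F) + 1"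
      using finF by (simp add: dim_insert_finite)
    finally show ?thesis
      using that[OF bs dimF] dimF by simp
  qed
qed

text \<open>A fixed index \<open>i\<close> of a block \<open>P\<close> lies in no other block. If
  \<open>sum e P\<close> were spanned by the other sums, then \<open>e i\<close> would be spanned by
  the remaining vectors of the independent family.\<close>

lemma dim_block_sums:
  fixes e :: "'i \<Rightarrow> 'v"
  assumes "finite K" "finite Z" "inj_on e (K \<union> Z)" "independent (e ` (K \<union> Z))" "block_system K Z F"
  shows "dim (sum e ` F) = card F"
proof -
  have "dim (sum e ` G) = card G" if "G \<subseteq> F" for G
  proof -
    have "finite G"
      using that finite_block_system[OF assms(5,1,2)] finite_subset by blast
    then show ?thesis
      using that
    proof (induction rule: finite_induct)
      case empty
      then show ?case
        using dim_eq_card_independent[OF independent_empty] by simp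
    next
      case (insert P G)
      have P: "P \<subseteq> K \<union> Z" "P \<noteq> {}" "P \<in> F"
        using insert.prems block_system_subset[OF assms(5)] block_system_nonempty[OF assms(5)] by auto
      then obtain i where i: "i \<in> P"
        by blast
      let ?E = "e ` (K \<union> Z - {i})"
      have finP: "finite P"
        using P(1) assms(1,2) finite_subset by auto
      have "sum e Q \<in> span ?E" if "Q \<in> G" for Q
      proof -
        have Q: "Q \<in> F" "Q \<noteq> P"
          using that insert by auto
        then have "disjnt P Q"
          using P(3) assms(5) unfolding block_system_def pairwise_def by blast
        then have "Q \<subseteq> K \<union> Z - {i}"
          using i block_system_subset[OF assms(5) Q(1)] by (auto simp: disjnt_def)
        then show ?thesis
          by (intro span_sum span_base) auto
      qed
      then have "sum e ` G \<subseteq> span ?E"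
        by blast
      then have G: "span (sum e ` G) \<subseteq> span ?E"
        by (simp add: span_minimal)
      have "sum e P \<notin> span (sum e ` G)"
      proof
        assume "sum e P \<in> span (sum e ` G)"
        then have "sum e P \<in> span ?E"
          using G by blast
        moreover have "sum e (P - {i}) \<in> span ?E"
          using P(1) by (intro span_sum span_base) auto
        ultimately have "sum e P - sum e (P - {i}) \<in> span ?E"
          by (rule span_diff)
        then have "e i \<in> span ?E"
          using i finP by (simp add: sum.remove)
        moreover have "?E = e ` (K \<union> Z) - {e i}"
          using assms(3) i P(1) by (subst inj_on_image_set_diff[of e "K \<union> Z"]) auto
        ultimately show False
          using assms(4) i P(1) unfolding dependent_def by auto
      qed
      then show ?case
        using insert by (simp add: dim_insert_finite)
    qed
  qed
  then show ?thesis by blast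
qed

text \<open>Let X' be the span of the \<open>l i\<close> with \<open>i\<close> outside
  \<open>Z'\<close>. Starting \<open>F\<close> with blocks independent modulo X' makes the joint
  span of X' and the sums over \<open>F\<close> large, which forces the second use of
  \<open>exists_block_system\<close> to return enough blocks.\<close>

lemma exists_jointly_independent_block_systems:
  fixes e l :: "'i \<Rightarrow> 'v"
  assumes fin: "finite I" and sub: "Z \<subseteq> I" "Z' \<subseteq> I"
    and inj: "inj_on e I" "inj_on l I" and ind: "independent (e ` I)" "independent (l ` I)"
  obtains F G where "block_system (I - Z) Z F" "block_system (I - Z') Z' G"
    "card I \<le> 2 * card F + 4" "card I \<le> 2 * card G + 4"
    "dim (sum e ` F \<union> sum l ` G) = card F + card G"
proof -
  let ?K = "I - Z" and ?K' = "I - Z'" and ?n = "card I"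
  have Un: "?K \<union> Z = I" "?K' \<union> Z' = I"
    using sub by auto
  have finZ: "finite Z" "finite Z'"
    using sub fin finite_subset by auto
  have cK': "card ?K' + card Z' = ?n"
    using sub fin finZ by (simp add: card_Diff_subset card_mono)
  have dim_eI: "dim (e ` I) = ?n" and dim_lI: "dim (l ` I) = ?n"
    using dim_eq_card_independent ind inj by (auto simp: card_image)
  have dim_lK': "dim (l ` ?K') = card ?K'"
    using dim_eq_card_independent[of "l ` ?K'"] independent_mono[OF ind(2), of "l ` ?K'"]
      inj_on_subset[OF inj(2), of ?K'] by (auto simp: card_image)
  obtain F1 where F1: "block_system ?K Z F1"
    "dim (l ` ?K' \<union> sum e ` F1) = dim (l ` ?K') + card F1"
    "dim (l ` ?K' \<union> e ` (?K \<union> Z)) \<le> dim (l ` ?K') + card F1 + 1 \<or>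
     2 * dim (l ` ?K' \<union> e ` ?K) + card Z \<le> 2 * (dim (l ` ?K') + card F1 + 1)"
    using exists_block_system[of ?K Z "l ` ?K'" e] fin finZ by auto
  \<comment> \<open>Rounded so that \<open>card Z' \<le> 2 * u + 2\<close>, also when
    \<open>Z'\<close> is empty and \<open>u\<close> is 0.\<close>
  define u where "u = (card Z' - 1) div 2"
  have n_le: "?n \<le> dim (l ` ?K' \<union> e ` I)"
    using dim_mono_finite[of "l ` ?K' \<union> e ` I" "e ` I"] fin dim_eI by (auto intro: span_base)
  have "dim (l ` ?K' \<union> e ` I) \<le> dim (l ` ?K' \<union> e ` ?K) + card Z"
    using dim_union_le[of "l ` ?K' \<union> e ` ?K" Z e] fin finZ Un(1)
    by (metis finite_Diff finite_UnI finite_imageI image_Un sup_assoc)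
  moreover have "card ?K' \<le> dim (l ` ?K' \<union> e ` ?K)"
    using dim_mono_finite[of "l ` ?K' \<union> e ` ?K" "l ` ?K'"] fin dim_lK' by (auto intro: span_base)
  \<comment> \<open>The first alternative gives \<open>card Z' \<le> card F1 + 1\<close>. In the
    second, the dimension on the left is at least \<open>?n - card Z\<close> and at least
    \<open>card ?K'\<close>; adding both bounds gives
    \<open>card Z' \<le> 2 * card F1 + 2\<close>.\<close>
  ultimately have "u \<le> card F1"
    using F1(3) n_le cK' dim_lK' Un(1) by (auto simp: u_def)
  then obtain F0 where F0: "F0 \<subseteq> F1" "card F0 = u"
    using obtain_subset_with_card_n by metis
  have finF1: "finite F1"
    using F1(1) finite_block_system fin finZ by blast
  have dimF0: "dim (l ` ?K' \<union> sum e ` F0) = card ?K' + u"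
    using dim_subfamily[OF _ finF1 F1(2) F0(1)] fin F0(2) dim_lK' by simp
  have "card F0 \<le> ?n div 2"
    using F0(2) cK' by (auto simp: u_def)
  \<comment> \<open>The blocks added here ignore X'; that all sums over \<open>F\<close> are
    independent among themselves follows from disjointness.\<close>
  then obtain F where F: "F0 \<subseteq> F" "block_system ?K Z F" "card F = ?n div 2"
    using extend_block_system[of ?K Z "?n div 2" F0] fin finZ Un(1)
      block_system_mono[OF F1(1) F0(1)] by auto
  have finF: "finite F"
    using F(2) finite_block_system fin finZ by blast
  have dimF: "dim (sum e ` F) = card F"
    using dim_block_sums[of ?K Z e F] fin finZ F(2) inj(1) ind(1) Un(1) by simp
  obtain G where G: "block_system ?K' Z' G" "dim (sum e ` F \<union> sum l ` G) = dim (sum e ` F) + card G"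
    "dim (sum e ` F \<union> l ` (?K' \<union> Z')) \<le> dim (sum e ` F) + card G + 1 \<or>
     2 * dim (sum e ` F \<union> l ` ?K') + card Z' \<le> 2 * (dim (sum e ` F) + card G + 1)"
    using exists_block_system[of ?K' Z' "sum e ` F" l] fin finZ finF by auto
  have "?n \<le> dim (sum e ` F \<union> l ` I)"
    using dim_mono_finite[of "sum e ` F \<union> l ` I" "l ` I"] fin finF dim_lI by (auto intro: span_base)
  moreover have "card ?K' + u \<le> dim (sum e ` F \<union> l ` ?K')"
    unfolding dimF0[symmetric] using F(1) fin finF
    by (intro dim_mono_finite) (auto intro!: span_base)
  \<comment> \<open>The first alternative gives \<open>?n \<le> card F + card G + 1\<close>. In the
    second the left side is at least \<open>2 * (card ?K' + u) + card Z'\<close>, hence at least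
    \<open>2 * ?n - 2\<close>; with \<open>card F = ?n div 2\<close> this costs the 4.\<close>
  ultimately have "?n \<le> 2 * card G + 4"
    using G(3) dimF F(3) cK' Un(2) by (auto simp: u_def)
  then show ?thesis
    using that[OF F(2) G(1)] G(2) F(3) dimF by simp
qed

section \<open>Functionals and dual families\<close>

text \<open>The dimension hypothesis makes \<open>f\<close> injective on \<open>A\<close> with
  independent image, so values prescribed on indices become values on vectors and extend linearly.
  This solves the system of block equations.\<close>

lemma exists_functional:
  assumes "finite A" "dim (f ` A) = card A"
  obtains h :: "'v \<Rightarrow> bit" where "additive h" "\<And>c x. h (scale c x) = c * h x"
    "\<And>a. a \<in> A \<Longrightarrow> h (f a) = \<alpha> a"
proof -
  obtain B where B: "B \<subseteq> f ` A" "independent B" "card B = dim (f ` A)"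
    using basis_exists by blast
  have "card (f ` A) \<le> card A"
    using assms(1) by (rule card_image_le)
  then have "B = f ` A"
    using B assms by (intro card_seteq) auto
  then have ind: "independent (f ` A)" and "card (f ` A) = card A"
    using B assms(2) by auto
  then have inj: "inj_on f A"
    using assms(1) by (intro eq_card_imp_inj_on)
  interpret vector_space_pair scale "(*) :: bit \<Rightarrow> bit \<Rightarrow> bit"
    by unfold_locales (rule distrib_left distrib_right mult.assoc[symmetric] mult_1_left)+
  obtain h where h: "Vector_Spaces.linear scale (*) h" "\<forall>x\<in>f ` A. h x = \<alpha> (inv_into A f x)"
    using linear_independent_extend[OF ind, of "\<lambda>x. \<alpha> (inv_into A f x)"] by blast
  interpret h: Vector_Spaces.linear scale "(*)" h
    by (rule h(1))
  show ?thesis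
  proof
    show "additive h"
      by unfold_locales (rule h.add)
    show "h (scale c x) = c * h x" for c x
      by (rule h.scale)
    show "h (f a) = \<alpha> a" if "a \<in> A" for a
      using h(2) that inj by simp
  qed
qed

text \<open>Each \<open>\<phi> i\<close> vanishes on the span of the other \<open>e j\<close> but
  not at \<open>e i\<close>.\<close>

lemma independent_of_dual_family:
  assumes "\<And>i. i \<in> I \<Longrightarrow> additive (\<phi> i)"
    and "\<And>i j. i \<in> I \<Longrightarrow> j \<in> I \<Longrightarrow> \<phi> i (e j) = (if i = j then 1 else 0 :: bit)"
  shows "inj_on e I" "independent (e ` I)"
proof -
  show "inj_on e I"
    using assms(2) by (metis inj_onI zero_neq_one)
  show "independent (e ` I)"
  proof
    assume "dependent (e ` I)"
    then obtain i where i: "i \<in> I" "e i \<in> span (e ` I - {e i})"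
      unfolding dependent_def by blast
    interpret additive "\<phi> i"
      using assms(1) i(1) .
    have "subspace {x. \<phi> i x = 0}"
    proof (rule subspaceI)
      fix c :: bit and x
      assume "x \<in> {x. \<phi> i x = 0}"
      then show "scale c x \<in> {x. \<phi> i x = 0}"
        by (cases c) (simp_all add: zero)
    qed (simp_all add: zero add)
    moreover have "e ` I - {e i} \<subseteq> {x. \<phi> i x = 0}"
      using assms(2) i(1) by auto
    ultimately have "\<phi> i (e i) = 0"
      using i(2) span_minimal by blast
    then show False
      using assms(2)[OF i(1) i(1)] by simp
  qed
qed

end

section \<open>Block sums and Hamming distance\<close>

lemma block_sum_eq_0:
  fixes z :: "'i \<Rightarrow> bit"
  assumes "block_system K Z F" "P \<in> F" "\<And>i. i \<in> K \<Longrightarrow> z i = 0" "\<And>i. i \<in> Z \<Longrightarrow> z i = 1"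
  shows "sum z P = 0"
proof -
  consider i where "i \<in> K" "P = {i}" | "P \<subseteq> Z" "card P = 2"
    using assms(1,2) unfolding block_system_def by blast
  then show ?thesis
  proof cases
    case 1
    then show ?thesis
      using assms(3) by simp
  next
    case 2
    then have "sum z P = (\<Sum>i\<in>P. 1)"
      using assms(4) by (intro sum.cong) auto
    then show ?thesis
      using 2 by simp
  qed
qed

text \<open>A block sum of 1 forces a differing coordinate inside the block, and disjoint blocks
  give distinct coordinates.\<close>

lemma card_le_hamming_dist:
  fixes x y :: "bit vec"
  assumes "disjoint F" "\<And>P. P \<in> F \<Longrightarrow> P \<subseteq> {..<dim_vec x}"
    and "\<And>P. P \<in> F \<Longrightarrow> (\<Sum>i\<in>P. x $ i + y $ i) = 1"
  shows "card F \<le> hamming_dist x y"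
proof -
  let ?D = "{i. i < dim_vec x \<and> x $ i \<noteq> y $ i}"
  have "\<exists>i\<in>P. x $ i \<noteq> y $ i" if "P \<in> F" for P
  proof (rule ccontr)
    assume "\<not> (\<exists>i\<in>P. x $ i \<noteq> y $ i)"
    then have "(\<Sum>i\<in>P. x $ i + y $ i) = 0"
      by (intro sum.neutral) simp
    then show False
      using assms(3)[OF that] by simp
  qed
  then obtain f where f: "\<And>P. P \<in> F \<Longrightarrow> f P \<in> P \<and> x $ f P \<noteq> y $ f P"
    by metis
  have "inj_on f F"
    using f assms(1) unfolding pairwise_def disjnt_def inj_on_def by (metis IntI empty_iff)
  moreover have "f ` F \<subseteq> ?D"
    using f assms(2) by fastforce
  ultimately show ?thesis
    unfolding hamming_dist_def by (intro card_inj_on_le[of f F ?D]) auto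
qed

section \<open>Coordinate functionals of additive maps\<close>

text \<open>Functionals are stored as coefficient functions on all of \<open>nat\<close>: these form
  a group as a type, whereas vectors of dimension \<open>n\<close> form only a carrier set.\<close>

interpretation coeffs: bit_vector_space "\<lambda>(c :: bit) (f :: nat \<Rightarrow> bit) i. c * f i"
  by unfold_locales (auto simp: fun_eq_iff algebra_simps)

text \<open>The coefficients of the linear functional \<open>y \<mapsto> (M y)\<^sub>i\<close>.\<close>

definition coord_coeffs :: "nat \<Rightarrow> (bit vec \<Rightarrow> bit vec) \<Rightarrow> nat \<Rightarrow> nat \<Rightarrow> bit" where
  "coord_coeffs n M i = (\<lambda>j. if j < n then M (unit_vec n j) $ i else 0)"

text \<open>Over bits additivity amounts to linearity, so this is all that is checked for the
  inverse of \<open>L\<close>.\<close>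

locale additive_vec_map =
  fixes n :: nat and M :: "bit vec \<Rightarrow> bit vec"
  assumes map_carrier: "\<And>x. x \<in> carrier_vec n \<Longrightarrow> M x \<in> carrier_vec n"
    and map_add: "\<And>x y. x \<in> carrier_vec n \<Longrightarrow> y \<in> carrier_vec n \<Longrightarrow> M (x + y) = M x + M y"
begin

lemma map_zero: "M (0\<^sub>v n) = 0\<^sub>v n"
proof -
  have c: "M (0\<^sub>v n) \<in> carrier_vec n"
    by (simp add: map_carrier)
  have "M (0\<^sub>v n) = M (0\<^sub>v n) + M (0\<^sub>v n)"
    using map_add[of "0\<^sub>v n" "0\<^sub>v n"] by simp
  then have "M (0\<^sub>v n) $ i = M (0\<^sub>v n) $ i + M (0\<^sub>v n) $ i" if "i < n" for i
    using c that by (metis carrier_vecD index_add_vec(1))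
  then show ?thesis
    using c by (intro eq_vecI) auto
qed

lemma map_nth:
  assumes "y \<in> carrier_vec n" "i < n"
  shows "M y $ i = (\<Sum>j<n. coord_coeffs n M i j * y $ j)"
proof -
  \<comment> \<open>The truncations \<open>t k\<close> lead from zero to \<open>y\<close>, each step
    adding nothing or one unit vector.\<close>
  define t where "t k = vec n (\<lambda>j. if j < k then y $ j else 0)" for k
  have t: "t k \<in> carrier_vec n" for k
    by (simp add: t_def)
  have "M (t k) $ i = (\<Sum>j<k. coord_coeffs n M i j * y $ j)" if "k \<le> n" for k
    using that
  proof (induction k)
    case 0
    have "t 0 = 0\<^sub>v n"
      by (auto simp: t_def)
    then show ?case
      using map_zero assms(2) by simp
  next
    case (Suc k)
    show ?case
    proof (cases "y $ k = 0")
      case True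
      then have "t (Suc k) = t k"
        by (auto simp: t_def less_Suc_eq)
      then show ?thesis
        using Suc True by simp
    next
      case False
      then have "t (Suc k) = t k + unit_vec n k"
        using Suc.prems by (intro eq_vecI) (auto simp: t_def less_Suc_eq)
      then have "M (t (Suc k)) = M (t k) + M (unit_vec n k)"
        using t by (simp add: map_add)
      then have "M (t (Suc k)) $ i = M (t k) $ i + M (unit_vec n k) $ i"
        using map_carrier[of "unit_vec n k"] assms(2) by simp
      then show ?thesis
        using Suc False by (simp add: coord_coeffs_def)
    qed
  qed
  moreover have "t n = y"
    using assms(1) by (auto simp: t_def)
  ultimately show ?thesis
    by (metis order_refl)
qed

text \<open>Evaluation at the preimages of the unit vectors is a dual family.\<close>

lemma coord_coeffs_independent:
  assumes "bij_betw M (carrier_vec n) (carrier_vec n)"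
  shows "inj_on (coord_coeffs n M) {..<n}" "coeffs.independent (coord_coeffs n M ` {..<n})"
proof -
  have "\<exists>y\<in>carrier_vec n. M y = unit_vec n i" for i
    using assms unfolding bij_betw_def by (metis imageE unit_vec_carrier)
  then obtain y where y: "\<And>i. y i \<in> carrier_vec n" "\<And>i. M (y i) = unit_vec n i"
    by metis
  define \<phi> where "\<phi> i f = (\<Sum>j<n. f j * y i $ j)" for i and f :: "nat \<Rightarrow> bit"
  have add: "additive (\<phi> i)" for i
    by unfold_locales
      (simp add: \<phi>_def algebra_simps sum.distrib)
  have dual: "\<phi> i (coord_coeffs n M k) = (if i = k then 1 else 0)" if "i < n" "k < n" for i k
  proof -
    have "\<phi> i (coord_coeffs n M k) = M (y i) $ k"
      unfolding \<phi>_def by (rule map_nth[OF y(1) that(2), symmetric])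
    then show ?thesis
      using y(2) that by simp
  qed
  show "inj_on (coord_coeffs n M) {..<n}" "coeffs.independent (coord_coeffs n M ` {..<n})"
    using coeffs.independent_of_dual_family[of "{..<n}" \<phi> "coord_coeffs n M"] add dual by auto
qed

text \<open>Double duality: \<open>h\<close> acts as evaluation at a vector that depends on
  \<open>h\<close> alone, so one vector serves several maps \<open>M\<close>.\<close>

lemma functional_coord_coeffs:
  assumes "additive h" "\<And>c x. h (\<lambda>j. c * x j) = c * h x" "i < n"
  shows "h (coord_coeffs n M i) = M (vec n (\<lambda>j. h (\<lambda>k. if k = j then 1 else 0))) $ i"
proof -
  interpret additive h
    by fact
  have "coord_coeffs n M i = (\<Sum>j<n. (\<lambda>k. coord_coeffs n M i j * (if k = j then 1 else 0)))"
    by (auto simp: fun_eq_iff sum_apply coord_coeffs_def if_distrib cong: if_cong)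
  then have "h (coord_coeffs n M i) =
      h (\<Sum>j<n. (\<lambda>k. coord_coeffs n M i j * (if k = j then 1 else 0)))"
    by (rule arg_cong)
  also have "\<dots> = (\<Sum>j<n. coord_coeffs n M i j * h (\<lambda>k. if k = j then 1 else 0))"
    unfolding sum assms(2) ..
  finally show ?thesis
    using assms(3) by (simp add: map_nth)
qed

end

section \<open>Vectors far from both centres, and the covering theorem\<close>

lemma exists_far_vector:
  assumes M: "additive_vec_map n M" "bij_betw M (carrier_vec n) (carrier_vec n)"
    and x: "x\<^sub>1 \<in> carrier_vec n" "x\<^sub>2 \<in> carrier_vec n" and z: "z \<in> carrier_vec n"
  obtains y where "y \<in> carrier_vec n"
    "n \<le> 2 * hamming_dist x\<^sub>1 y + 4" "n \<le> 2 * hamming_dist x\<^sub>1 (y + z) + 4"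
    "n \<le> 2 * hamming_dist x\<^sub>2 (M y) + 4" "n \<le> 2 * hamming_dist x\<^sub>2 (M (y + z)) + 4"
proof -
  interpret M: additive_vec_map n M
    by (rule M(1))
  interpret E: additive_vec_map n id
    by unfold_locales simp_all
  let ?e = "coord_coeffs n id" and ?l = "coord_coeffs n M" and ?I = "{..<n}"
  let ?supp = "\<lambda>z. {i\<in>?I. z $ i = 1}"
  obtain F G where F: "block_system (?I - ?supp z) (?supp z) F"
    and G: "block_system (?I - ?supp (M z)) (?supp (M z)) G"
    and card: "n \<le> 2 * card F + 4" "n \<le> 2 * card G + 4"
    and dim: "coeffs.dim (sum ?e ` F \<union> sum ?l ` G) = card F + card G"
    using coeffs.exists_jointly_independent_block_systems
        [of ?I "?supp z" "?supp (M z)" ?e ?l]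
      E.coord_coeffs_independent M.coord_coeffs_independent M(2) by auto
  have fin: "finite F" "finite G"
    using finite_block_system[OF F] finite_block_system[OF G] by auto
  \<comment> \<open>With these values the coordinates of \<open>w + N y\<close> sum to 1 over each
    block.\<close>
  define \<alpha> where "\<alpha> w P = 1 + (\<Sum>i\<in>P. w $ i)" for w :: "bit vec" and P
  \<comment> \<open>The disjoint sum keeps a block occurring in both \<open>F\<close> and
    \<open>G\<close> as two separate equations.\<close>
  have img: "case_sum (sum ?e) (sum ?l) ` (F <+> G) = sum ?e ` F \<union> sum ?l ` G"
    by (force simp: Plus_def image_Un image_image)
  obtain h where h: "additive h" "\<And>c x. h (\<lambda>i. c * x i) = c * h x"
    and val: "\<And>a. a \<in> F <+> G \<Longrightarrow> h (case_sum (sum ?e) (sum ?l) a) = case_sum (\<alpha> x\<^sub>1) (\<alpha> x\<^sub>2) a"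
    using coeffs.exists_functional[of "F <+> G" "case_sum (sum ?e) (sum ?l)" "case_sum (\<alpha> x\<^sub>1) (\<alpha> x\<^sub>2)"]
      fin dim img by (auto simp: card_Plus)
  define y where "y = vec n (\<lambda>j. h (\<lambda>k. if k = j then 1 else 0))"
  have y: "y \<in> carrier_vec n"
    by (simp add: y_def)
  \<comment> \<open>Used twice: for the identity with the blocks \<open>F\<close>, and for
    \<open>M\<close> with the blocks \<open>G\<close>.\<close>
  have far: "n \<le> 2 * hamming_dist w (N y) + 4 \<and> n \<le> 2 * hamming_dist w (N (y + z)) + 4"
    if N: "additive_vec_map n N" and w: "w \<in> carrier_vec n"
      and D: "block_system (?I - ?supp (N z)) (?supp (N z)) D"
      and cD: "n \<le> 2 * card D + 4" and v: "\<And>P. P \<in> D \<Longrightarrow> h (sum (coord_coeffs n N) P) = \<alpha> w P"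
    for N w D
  proof -
    interpret N: additive_vec_map n N
      by (rule N)
    interpret h: additive h
      by (rule h(1))
    have sub: "P \<subseteq> ?I" if "P \<in> D" for P
      using block_system_subset[OF D that] by auto
    have one: "(\<Sum>i\<in>P. w $ i + N y $ i) = 1" if "P \<in> D" for P
    proof -
      have "(\<Sum>i\<in>P. N y $ i) = (\<Sum>i\<in>P. h (coord_coeffs n N i))"
        using sub[OF that] N.functional_coord_coeffs[OF h] by (intro sum.cong) (auto simp: y_def)
      also have "\<dots> = 1 + (\<Sum>i\<in>P. w $ i)"
        using v[OF that] by (simp add: h.sum \<alpha>_def)
      finally show ?thesis
        by (simp add: sum.distrib add.left_commute)
    qed
    have Nyz: "N (y + z) $ i = N y $ i + N z $ i" if "i < n" for i
      using that N.map_add[OF y z] N.map_carrier[OF z] by simp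
    have "(\<Sum>i\<in>P. w $ i + N (y + z) $ i) = 1" if "P \<in> D" for P
    proof -
      have "(\<Sum>i\<in>P. w $ i + N (y + z) $ i) = (\<Sum>i\<in>P. (w $ i + N y $ i) + N z $ i)"
        using sub[OF that] Nyz by (intro sum.cong) (auto simp: add.assoc)
      also have "\<dots> = 1 + (\<Sum>i\<in>P. N z $ i)"
        using one[OF that] by (simp add: sum.distrib)
      also have "(\<Sum>i\<in>P. N z $ i) = 0"
        by (rule block_sum_eq_0[OF D that]) auto
      finally show ?thesis
        by simp
    qed
    then have "card D \<le> hamming_dist w (N (y + z))" "card D \<le> hamming_dist w (N y)"
      using card_le_hamming_dist[of D w] D sub one w by (auto simp: block_system_def)
    then show ?thesis
      using cD by linarith
  qed
  have "h (sum ?e P) = \<alpha> x\<^sub>1 P" if "P \<in> F" for P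
    using val[of "Inl P"] that by auto
  then have "n \<le> 2 * hamming_dist x\<^sub>1 y + 4 \<and> n \<le> 2 * hamming_dist x\<^sub>1 (y + z) + 4"
    using far[of id x\<^sub>1 F] E.additive_vec_map_axioms x(1) F card(1) by simp
  moreover have "h (sum ?l P) = \<alpha> x\<^sub>2 P" if "P \<in> G" for P
    using val[of "Inr P"] that by auto
  then have "n \<le> 2 * hamming_dist x\<^sub>2 (M y) + 4 \<and> n \<le> 2 * hamming_dist x\<^sub>2 (M (y + z)) + 4"
    using far[of M x\<^sub>2 G] M(1) x(2) G card(2) by simp
  ultimately show ?thesis
    using that y by blast
qed

theorem theorem1:
  shows "\<exists>n\<^sub>0::nat. \<forall>n\<ge>n\<^sub>0. \<forall>(L :: bit vec \<Rightarrow> bit vec) (x\<^sub>1 :: bit vec) (x\<^sub>2 :: bit vec) (r :: real)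
           (A\<^sub>1 :: bit vec set) (A\<^sub>2 :: bit vec set) (S :: bit vec set).
           invertible_linear_map n L \<longrightarrow>
           x\<^sub>1 \<in> carrier_vec n \<longrightarrow> x\<^sub>2 \<in> carrier_vec n \<longrightarrow>
           r < real n / 2 - 7 \<longrightarrow>
           A\<^sub>1 = hamming_ball n r x\<^sub>1 \<longrightarrow> A\<^sub>2 = L ` hamming_ball n r x\<^sub>2 \<longrightarrow>
           S \<subseteq> carrier_vec n \<longrightarrow>
           carrier_vec n = A\<^sub>1 \<union> A\<^sub>2 \<union> S \<longrightarrow>
           S + S = carrier_vec n"
proof (intro exI[of _ 0] allI impI)
  fix n :: nat and L :: "bit vec \<Rightarrow> bit vec" and x\<^sub>1 x\<^sub>2 :: "bit vec" and r :: real
    and A\<^sub>1 A\<^sub>2 S :: "bit vec set"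
  assume L: "invertible_linear_map n L"
    and x: "x\<^sub>1 \<in> carrier_vec n" "x\<^sub>2 \<in> carrier_vec n" and r: "r < real n / 2 - 7"
    and A: "A\<^sub>1 = hamming_ball n r x\<^sub>1" "A\<^sub>2 = L ` hamming_ball n r x\<^sub>2"
    and S: "S \<subseteq> carrier_vec n" and cover: "carrier_vec n = A\<^sub>1 \<union> A\<^sub>2 \<union> S"
  let ?V = "carrier_vec n :: bit vec set"
  have bij: "bij_betw L ?V ?V"
    using L by (simp add: invertible_linear_map_def)
  interpret L: linear_map class_ring "module_vec TYPE(bit) n" "module_vec TYPE(bit) n" L
    using L by (simp add: invertible_linear_map_def)
  have L_add: "L (x + y) = L x + L y" if "x \<in> ?V" "y \<in> ?V" for x y
    using L.T_add[of x y] that by (simp add: module_vec_simps)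
  define M where "M = inv_into ?V L"
  have bijM: "bij_betw M ?V ?V"
    unfolding M_def using bij by (rule bij_betw_inv_into)
  have inv_L: "M (L x) = x" if "x \<in> ?V" for x
    using that bij by (simp add: M_def bij_betw_inv_into_left)
  have L_inv: "L (M x) = x" if "x \<in> ?V" for x
    using that bij by (simp add: M_def bij_betw_inv_into_right)
  have Mc: "M x \<in> ?V" if "x \<in> ?V" for x
    using that bijM by (rule bij_betwE[rule_format, rotated])
  have "M (x + y) = M x + M y" if "x \<in> ?V" "y \<in> ?V" for x y
    using inv_L[of "M x + M y"] L_add[of "M x" "M y"] L_inv Mc that by simp
  then have M: "additive_vec_map n M"
    using Mc by unfold_locales
  \<comment> \<open>The bounds say that both distances are at least \<open>n / 2 - 2\<close>, which
    exceeds \<open>r\<close> for every \<open>n\<close>; hence the witness 0. Membership in the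
    image under \<open>L\<close> is tested by applying its inverse \<open>M\<close>.\<close>
  have in_S: "y \<in> S" if "y \<in> ?V" "n \<le> 2 * hamming_dist x\<^sub>1 y + 4" "n \<le> 2 * hamming_dist x\<^sub>2 (M y) + 4" for y
  proof -
    have "y \<notin> A\<^sub>1"
      using that(2) r by (auto simp: A hamming_ball_def)
    moreover have "y \<notin> A\<^sub>2"
    proof
      assume "y \<in> A\<^sub>2"
      then obtain w where w: "w \<in> ?V" "y = L w" "real (hamming_dist x\<^sub>2 w) \<le> r"
        by (auto simp: A hamming_ball_def)
      then show False
        using that(3) r inv_L by auto
    qed
    ultimately show ?thesis
      using that(1) cover by blast
  qed
  show "S + S = ?V"
  proof
    show "S + S \<subseteq> ?V"
      using S by (auto simp: set_plus_def intro!: add_carrier_vec)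
    show "?V \<subseteq> S + S"
    proof
      fix z :: "bit vec" assume z: "z \<in> ?V"
      obtain y where y: "y \<in> ?V"
        "n \<le> 2 * hamming_dist x\<^sub>1 y + 4" "n \<le> 2 * hamming_dist x\<^sub>1 (y + z) + 4"
        "n \<le> 2 * hamming_dist x\<^sub>2 (M y) + 4" "n \<le> 2 * hamming_dist x\<^sub>2 (M (y + z)) + 4"
        using exists_far_vector[OF M bijM x z] by blast
      have "y \<in> S" "y + z \<in> S"
        using in_S y z by auto
      moreover have "z = y + (y + z)"
        using y(1) z by (intro eq_vecI) (auto simp flip: add.assoc)
      ultimately show "z \<in> S + S"
        by (auto simp: set_plus_def)
    qed
  qed
qed

end
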